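(* Let $\Gamma\subseteq\mathrm{Sym}(N)$ be a permutation group. A spherical arrangement $v$ in $\mathbb{R}^d$ whose arrangement space is a $\Gamma$-invariant subspace of $\mathbb{R}^n$ is a $\Gamma$-arrangement. Moreover, its representation can be chosen as $$T_\phi:=M^\top P_\phi M\quad\text{for all }\phi\in\Gamma,$$ where $M$ is the matrix of the arrangement.
   Context: Let $n\ge 1$ and $N=\{1,\dots,n\}$. A ($d$-dimensional) arrangement is a family of points $v_i\in\mathbb{R}^d$, $i\in N$. Its matrix $M\in\mathbb{R}^{n\times d}$ has $i$-th row $v_i^\top$, and its arrangement space is the column span $U=\mathrm{span}\,M\subseteq\mathbb{R}^n$. An arrangement is spherical if $M^\top M=\alpha\,\mathrm{Id}$ for some $\alpha\in\mathbb{R}\setminus\{0\}$. For a permutation group $\Gamma\subseteq\mathrm{Sym}(N)$, an arrangement $v$ in $\mathbb{R}^d$ is a $\Gamma$-arrangement if there is a group homomorphism $T\colon\Gamma\to\mathrm{O}(\mathbb{R}^d)$, called a representation of $v$, with $T_\phi v_i=v_{\phi(i)}$ for all $i\in N$, $\phi\in\Gamma$. The group $\Gamma$ acts on $\mathbb{R}^n$ by the permutation matrices $P_\phi$, where $P_\phi e_i=e_{\phi(i)}$ for the standard basis vectors $e_i$; a subspace $U\subseteq\mathbb{R}^n$ is $\Gamma$-invariant if $P_\phi U=U$ for all $\phi\in\Gamma$.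
   Formalization: The formula T_φ = MᵀP_φM is proved when MᵀM = Id; for general α it fails at φ = id (it gives α Id), and the corrected T_φ = (1/α) MᵀP_φM is proved for every α ≠ 0. The dimension d is at least 1. *)

theory Defs
  imports "HOL-Analysis.Analysis" "HOL-Algebra.Bij"
begin

text \<open>The index set N is the universe of a finite type \<open>'n\<close>, so that n is \<open>CARD('n)\<close>.\<close>

abbreviation Sym :: "('n \<Rightarrow> 'n) monoid" where
  "Sym \<equiv> BijGroup UNIV"

definition orthogonal_group :: "(real^'d^'d) monoid" where
  "orthogonal_group = \<lparr>carrier = {Q. orthogonal_matrix Q}, mult = (**), one = mat 1\<rparr>"

definition perm_matrix :: "('n \<Rightarrow> 'n) \<Rightarrow> real^'n^'n" where
  "perm_matrix \<phi> = (\<chi> i j. if i = \<phi> j then 1 else 0)"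

lemma perm_matrix_axis: "perm_matrix \<phi> *v axis j 1 = axis (\<phi> j) 1"
  by (simp add: perm_matrix_def matrix_vector_mult_def vec_eq_iff axis_def
      if_distrib[of "\<lambda>x. _ * x"] cong: if_cong)

definition arr_matrix :: "('n \<Rightarrow> real^'d) \<Rightarrow> real^'d^'n" where
  "arr_matrix v = (\<chi> i. v i)"

definition arr_space :: "('n::finite \<Rightarrow> real^'d) \<Rightarrow> (real^'n) set" where
  "arr_space v = span (columns (arr_matrix v))"

definition spherical_with :: "real \<Rightarrow> ('n::finite \<Rightarrow> real^'d) \<Rightarrow> bool" where
  "spherical_with \<alpha> v \<longleftrightarrow>
     \<alpha> \<noteq> 0 \<and> transpose (arr_matrix v) ** arr_matrix v = \<alpha> *\<^sub>R mat 1"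

definition spherical :: "('n::finite \<Rightarrow> real^'d) \<Rightarrow> bool" where
  "spherical v \<longleftrightarrow> (\<exists>\<alpha>. spherical_with \<alpha> v)"

definition invariant_subspace :: "('n \<Rightarrow> 'n) set \<Rightarrow> (real^'n::finite) set \<Rightarrow> bool" where
  "invariant_subspace \<Gamma> U \<longleftrightarrow>
     subspace U \<and> (\<forall>\<phi>\<in>\<Gamma>. (\<lambda>x. perm_matrix \<phi> *v x) ` U = U)"

definition is_representation ::
  "('n \<Rightarrow> 'n) set \<Rightarrow> ('n \<Rightarrow> real^'d) \<Rightarrow> (('n \<Rightarrow> 'n) \<Rightarrow> real^'d^'d) \<Rightarrow> bool" where
  "is_representation \<Gamma> v T \<longleftrightarrow>
     T \<in> hom (Sym\<lparr>carrier := \<Gamma>\<rparr>) orthogonal_group \<and>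
     (\<forall>\<phi>\<in>\<Gamma>. \<forall>i. T \<phi> *v v i = v (\<phi> i))"

definition symmetric_arrangement :: "('n \<Rightarrow> 'n) set \<Rightarrow> ('n \<Rightarrow> real^'d) \<Rightarrow> bool" where
  "symmetric_arrangement \<Gamma> v \<longleftrightarrow> (\<exists>T. is_representation \<Gamma> v T)"

end

theory Submission
  imports Defs
begin

text \<open>Write \<open>M\<close> for the matrix of the arrangement and \<open>P\<close> for a permutation matrix with \<open>\<phi> \<in> \<Gamma>\<close>.
  The spherical condition \<open>M\<^sup>T M = \<alpha> Id\<close> makes \<open>M M\<^sup>T / \<alpha>\<close> act as the identity on the arrangement space
  (\<open>projection_fixes_column_space\<close>). Invariance says that the columns of \<open>P M\<close> stay in that space, so
  the candidate \<open>T = M\<^sup>T P M / \<alpha>\<close> satisfies the intertwining relation \<open>M T = P M\<close> (\<open>compression_intertwines\<close>).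

  Everything else follows from this relation. Since \<open>M\<close> can be cancelled on the left, \<open>P\<close> being
  multiplicative in \<open>\<phi>\<close> forces \<open>T\<close> to be so. Since \<open>P\<close> is orthogonal, computing \<open>(M T)\<^sup>T (M T)\<close> in two
  ways shows that \<open>T\<close> is orthogonal. Finally, transposing the relation and multiplying by the orthogonal
  matrices \<open>T\<close> and \<open>P\<close> gives \<open>T M\<^sup>T = M\<^sup>T P\<close>, whose \<open>i\<close>-th columns are \<open>T (v i)\<close> and \<open>v (\<phi> i)\<close>.\<close>

lemma perm_matrix_comp:
  fixes \<phi> \<psi> :: "'n::finite \<Rightarrow> 'n"
  shows "perm_matrix (\<lambda>i. \<phi> (\<psi> i)) = perm_matrix \<phi> ** perm_matrix \<psi>"
proof -
  have "perm_matrix (\<lambda>i. \<phi> (\<psi> i)) *v axis j 1 = (perm_matrix \<phi> ** perm_matrix \<psi>) *v axis j 1" for j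
    by (simp add: perm_matrix_axis flip: matrix_vector_mul_assoc)
  then show ?thesis
    by (simp add: matrix_vector_mult_basis column_def vec_eq_iff)
qed

lemma orthogonal_perm_matrix:
  fixes \<phi> :: "'n::finite \<Rightarrow> 'n"
  assumes "inj \<phi>"
  shows "orthogonal_matrix (perm_matrix \<phi>)"
  unfolding orthogonal_matrix
  by (simp add: perm_matrix_def transpose_def matrix_matrix_mult_def mat_def vec_eq_iff
      inj_eq[OF assms] if_distrib[of "\<lambda>x. x * _"] cong: if_cong)

lemma arr_matrix_transpose_axis: "transpose (arr_matrix v) *v axis i 1 = v i"
  by (simp add: matrix_vector_mult_basis column_def transpose_def arr_matrix_def)

text \<open>A vector of the column space has the form \<open>A y\<close>, and \<open>A A\<^sup>T (A y) = A (\<alpha> y)\<close>.\<close>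

lemma projection_fixes_column_space:
  fixes A :: "real^'d^'n::finite"
  assumes "transpose A ** A = \<alpha> *\<^sub>R mat 1" and "x \<in> span (columns A)"
  shows "(A ** transpose A) *v x = \<alpha> *\<^sub>R x"
proof -
  have "span (columns A) \<subseteq> range ((*v) A)"
    by (intro span_minimal linear_subspace_image) (auto simp: columns_image_basis)
  then obtain y where y: "x = A *v y"
    using assms(2) by auto
  have "(A ** transpose A) *v x = A *v ((transpose A ** A) *v y)"
    by (simp add: y matrix_vector_mul_assoc matrix_mul_assoc)
  also have "\<dots> = \<alpha> *\<^sub>R x"
    by (simp add: y assms(1) matrix_vector_mult_scaleR flip: scaleR_matrix_vector_assoc)
  finally show ?thesis .
qed

text \<open>The factor \<open>A A\<^sup>T / \<alpha>\<close> on the left acts on the columns of \<open>P A\<close>, which invariance keeps in the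
  column space of \<open>A\<close>, where this factor is the identity.\<close>

lemma compression_intertwines:
  fixes A :: "real^'d^'n::finite" and P :: "real^'n^'n"
  assumes A: "transpose A ** A = \<alpha> *\<^sub>R mat 1" "\<alpha> \<noteq> 0"
    and P: "\<And>x. x \<in> span (columns A) \<Longrightarrow> P *v x \<in> span (columns A)"
  shows "A ** ((1 / \<alpha>) *\<^sub>R (transpose A ** P ** A)) = P ** A"
proof -
  have "(A ** ((1 / \<alpha>) *\<^sub>R (transpose A ** P ** A))) *v y = (P ** A) *v y" for y
  proof -
    have "(A ** (transpose A ** P ** A)) *v y = (A ** transpose A) *v (P *v (A *v y))"
      by (simp add: matrix_vector_mul_assoc matrix_mul_assoc)
    also have "\<dots> = \<alpha> *\<^sub>R (P *v (A *v y))"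
      by (intro projection_fixes_column_space A P matrix_vector_mult_in_columnspace)
    finally show ?thesis
      using A(2) by (simp add: matrix_scalar_ac matrix_vector_mul_assoc
          flip: scalar_matrix_assoc scaleR_matrix_vector_assoc)
  qed
  then show ?thesis
    by (simp add: matrix_eq)
qed

lemma scaled_isometry_cancel:
  fixes A :: "real^'d^'n::finite" and B C :: "real^'k^'d"
  assumes A: "transpose A ** A = \<alpha> *\<^sub>R mat 1" "\<alpha> \<noteq> 0" and eq: "A ** B = A ** C"
  shows "B = C"
proof -
  have "(transpose A ** A) ** B = (transpose A ** A) ** C"
    using eq by (metis matrix_mul_assoc)
  then show ?thesis
    using A by (simp flip: scalar_matrix_assoc)
qed

text \<open>Both sides of \<open>(A T)\<^sup>T (A T) = (P A)\<^sup>T (P A)\<close> collapse, to \<open>\<alpha> T\<^sup>T T\<close> and to \<open>\<alpha> Id\<close>.\<close>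

lemma intertwiner_orthogonal:
  fixes A :: "real^'d^'n::finite" and P :: "real^'n^'n"
  assumes A: "transpose A ** A = \<alpha> *\<^sub>R mat 1" "\<alpha> \<noteq> 0"
    and P: "orthogonal_matrix P" and AT: "A ** T = P ** A"
  shows "orthogonal_matrix T"
proof -
  have "\<alpha> *\<^sub>R (transpose T ** T) = transpose T ** (transpose A ** A) ** T"
    by (simp add: A(1) matrix_scalar_ac flip: scalar_matrix_assoc)
  also have "\<dots> = transpose (A ** T) ** (A ** T)"
    by (simp add: matrix_transpose_mul matrix_mul_assoc)
  also have "\<dots> = transpose A ** (transpose P ** P) ** A"
    by (simp add: AT matrix_transpose_mul matrix_mul_assoc)
  also have "\<dots> = \<alpha> *\<^sub>R mat 1"
    using P A(1) by (simp add: orthogonal_matrix_def)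
  finally show ?thesis
    using A(2) by (simp add: orthogonal_matrix)
qed

text \<open>For orthogonal \<open>P\<close> and \<open>T\<close> the transposed relation \<open>T\<^sup>T A\<^sup>T = A\<^sup>T P\<^sup>T\<close> involves the inverses of
  \<open>T\<close> and \<open>P\<close>, which can be moved across.\<close>

lemma intertwiner_transpose:
  fixes A :: "real^'d^'n::finite" and P :: "real^'n^'n"
  assumes P: "orthogonal_matrix P" and T: "orthogonal_matrix T" and AT: "A ** T = P ** A"
  shows "T ** transpose A = transpose A ** P"
proof -
  have "transpose A ** P = T ** (transpose T ** transpose A) ** P"
    using T by (simp add: orthogonal_matrix_def matrix_mul_assoc)
  also have "transpose T ** transpose A = transpose A ** transpose P"
    using AT by (metis matrix_transpose_mul)
  also have "T ** (transpose A ** transpose P) ** P = T ** transpose A ** (transpose P ** P)"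
    by (simp add: matrix_mul_assoc)
  finally show ?thesis
    using P by (simp add: orthogonal_matrix_def)
qed

text \<open>The factor \<open>1 / \<alpha>\<close> compensates for the squared length \<open>\<alpha>\<close> of the columns of \<open>M\<close>: at \<open>\<phi> = id\<close> the
  uncorrected product \<open>M\<^sup>T P M\<close> is \<open>\<alpha> Id\<close>, so it is a representation only for \<open>\<alpha> = 1\<close>.\<close>

lemma spherical_invariant_is_representation:
  fixes \<Gamma> :: "('n::finite \<Rightarrow> 'n) set" and v :: "'n \<Rightarrow> real^'d"
  assumes \<Gamma>: "subgroup \<Gamma> Sym" and v: "spherical_with \<alpha> v"
    and inv: "invariant_subspace \<Gamma> (arr_space v)"
  shows "is_representation \<Gamma> v
    (\<lambda>\<phi>. (1 / \<alpha>) *\<^sub>R (transpose (arr_matrix v) ** perm_matrix \<phi> ** arr_matrix v))"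
proof -
  define M where "M = arr_matrix v"
  define T where "T \<phi> = (1 / \<alpha>) *\<^sub>R (transpose M ** perm_matrix \<phi> ** M)" for \<phi>
  have M: "transpose M ** M = \<alpha> *\<^sub>R mat 1" "\<alpha> \<noteq> 0"
    using v by (auto simp: spherical_with_def M_def)
  have bij: "\<phi> \<in> Bij UNIV" if "\<phi> \<in> \<Gamma>" for \<phi>
    using subgroup.mem_carrier[OF \<Gamma> that] by (simp add: BijGroup_def)
  have mult: "\<phi> \<otimes>\<^bsub>Sym\<^esub> \<psi> = (\<lambda>i. \<phi> (\<psi> i))" if "\<phi> \<in> \<Gamma>" "\<psi> \<in> \<Gamma>" for \<phi> \<psi>
    using that by (simp add: BijGroup_def bij compose_def restrict_UNIV)
  have orth_P: "orthogonal_matrix (perm_matrix \<phi>)" if "\<phi> \<in> \<Gamma>" for \<phi>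
    using bij[OF that] by (intro orthogonal_perm_matrix) (simp add: Bij_def bij_betw_def)
  have MT: "M ** T \<phi> = perm_matrix \<phi> ** M" if "\<phi> \<in> \<Gamma>" for \<phi>
    unfolding T_def
    using inv that
    by (intro compression_intertwines M) (auto simp: invariant_subspace_def arr_space_def M_def)
  have orth_T: "orthogonal_matrix (T \<phi>)" if "\<phi> \<in> \<Gamma>" for \<phi>
    by (rule intertwiner_orthogonal[OF M orth_P[OF that] MT[OF that]])
  have "T (\<phi> \<otimes>\<^bsub>Sym\<^esub> \<psi>) = T \<phi> ** T \<psi>" if "\<phi> \<in> \<Gamma>" "\<psi> \<in> \<Gamma>" for \<phi> \<psi>
  proof (rule scaled_isometry_cancel[OF M])
    have "M ** T (\<phi> \<otimes>\<^bsub>Sym\<^esub> \<psi>) = perm_matrix \<phi> ** (perm_matrix \<psi> ** M)"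
      using MT[OF subgroup.m_closed[OF \<Gamma> that]] that
      by (simp add: mult perm_matrix_comp matrix_mul_assoc)
    also have "\<dots> = M ** (T \<phi> ** T \<psi>)"
      by (metis MT matrix_mul_assoc that)
    finally show "M ** T (\<phi> \<otimes>\<^bsub>Sym\<^esub> \<psi>) = M ** (T \<phi> ** T \<psi>)" .
  qed
  then have "T \<in> hom (Sym\<lparr>carrier := \<Gamma>\<rparr>) orthogonal_group"
    by (auto simp: hom_def orthogonal_group_def orth_T)
  moreover have "T \<phi> *v v i = v (\<phi> i)" if "\<phi> \<in> \<Gamma>" for \<phi> i
  proof -
    have "T \<phi> *v v i = (T \<phi> ** transpose M) *v axis i 1"
      by (simp add: M_def arr_matrix_transpose_axis flip: matrix_vector_mul_assoc
          del: transpose_matrix_vector)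
    also have "\<dots> = (transpose M ** perm_matrix \<phi>) *v axis i 1"
      using intertwiner_transpose[OF orth_P orth_T MT] that by simp
    also have "\<dots> = v (\<phi> i)"
      by (simp add: M_def arr_matrix_transpose_axis perm_matrix_axis flip: matrix_vector_mul_assoc
          del: transpose_matrix_vector)
    finally show ?thesis .
  qed
  ultimately have "is_representation \<Gamma> v T"
    by (simp add: is_representation_def)
  then show ?thesis
    by (simp add: T_def[abs_def] M_def)
qed

theorem theorem4p9:
  fixes \<Gamma> :: "('n::finite \<Rightarrow> 'n) set" and v :: "'n \<Rightarrow> real^'d"
  assumes "subgroup \<Gamma> Sym"
    and "spherical v"
    and "invariant_subspace \<Gamma> (arr_space v)"
  shows "symmetric_arrangement \<Gamma> v
    \<and> (spherical_with 1 v \<longrightarrow>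
         is_representation \<Gamma> v
           (\<lambda>\<phi>. transpose (arr_matrix v) ** perm_matrix \<phi> ** arr_matrix v))
    \<and> (\<forall>\<alpha>. spherical_with \<alpha> v \<longrightarrow>
         is_representation \<Gamma> v
           (\<lambda>\<phi>. (1 / \<alpha>) *\<^sub>R (transpose (arr_matrix v) ** perm_matrix \<phi> ** arr_matrix v)))"
proof (intro conjI allI impI)
  note rep = spherical_invariant_is_representation[OF assms(1) _ assms(3)]
  show "symmetric_arrangement \<Gamma> v"
    using assms(2) rep unfolding spherical_def symmetric_arrangement_def by blast
  show "is_representation \<Gamma> v (\<lambda>\<phi>. transpose (arr_matrix v) ** perm_matrix \<phi> ** arr_matrix v)"
    if "spherical_with 1 v"
    using rep[OF that] by simp
qed (rule spherical_invariant_is_representation[OF assms(1) _ assms(3)])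

end
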